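(* Let $G$ and $H$ be graphs and let $\mathcal K\subseteq\mathcal S_+$ be a matrix cone. Then $G\cong_{\mathcal K}H$ if and only if $\vartheta^{\mathcal K}(G\diamond H)=|V_G|=|V_H|$ and this value is attained.
   Context: Graphs are finite (with nonempty vertex set), simple and undirected. For vertices $x,y$ of the same graph, $\mathrm{rel}(x,y)$ denotes their relationship: equal, adjacent, or distinct non-adjacent. $\mathcal S_+$ is the cone of (Hermitian) positive semidefinite matrices (of all sizes); a matrix cone is a convex cone of matrices. $G\cong_{\mathcal K}H$ means: there is a matrix $M\in\mathcal K$ with rows and columns indexed by $V_G\times V_H$ such that $\sum_{h,h'\in V_H}M_{gh,g'h'}=1$ for all $g,g'\in V_G$; $\sum_{g,g'\in V_G}M_{gh,g'h'}=1$ for all $h,h'\in V_H$; and $M_{gh,g'h'}=0$ whenever $\mathrm{rel}(g,g')\neq\mathrm{rel}(h,h')$. The graph isomorphism product $G\diamond H$ has vertex set $V_G\times V_H$, with $(g,h)\sim(g',h')$ if and only if $\mathrm{rel}(g,g')\neq\mathrm{rel}(h,h')$. For a graph $F$, $\vartheta^{\mathcal K}(F)=\sup\{\mathrm{Tr}(MJ): M\in\mathcal K,\ \mathrm{Tr}(M)=1,\ M_{u,u'}=0 \text{ if } u\sim u' \text{ in } F\}$, where $M$ has rows and columns indexed by $V_F$ and $J$ is the all-ones matrix. "Attained" means that some feasible $M$ achieves the supremum. *)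

theory Defs
  imports
    "HOL-Library.Extended_Real"
    "Jordan_Normal_Form.Schur_Decomposition"
    "Graph_Theory.Pair_Digraph"
begin

text \<open>
  Finite simple undirected graphs are those of \<^locale>\<open>pair_graph\<close>: finite, loop-free, with a
  symmetric set of arcs.

  A set of matrices of all sizes is a \<^typ>\<open>complex mat set\<close>. Matrices of \<^typ>\<open>complex mat\<close> are
  indexed by natural numbers, so a matrix with rows and columns indexed by a finite set \<open>V\<close> is
  read through a labelling, a bijection \<open>\<iota>\<close> from \<open>V\<close> onto \<open>{..<card V}\<close>; its entry at \<open>(u, u')\<close>
  is \<open>M $$ (\<iota> u, \<iota> u')\<close>. A cone need not be invariant under simultaneous permutations of rows
  and columns, so \<open>\<iota>\<close> is a parameter of every notion that refers to such matrices.
\<close>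

definition trace_mat :: "complex mat \<Rightarrow> complex" where
  "trace_mat A = (\<Sum>i<dim_row A. A $$ (i, i))"

definition all_ones_mat :: "nat \<Rightarrow> complex mat" where
  "all_ones_mat n = mat n n (\<lambda>_. 1)"

text \<open>The order on \<^typ>\<open>complex\<close> below is that of \<^theory>\<open>HOL-Library.Complex_Order\<close>, so
  \<open>0 \<le> z\<close> includes that \<open>z\<close> is real.\<close>

definition psd_mats :: "complex mat set" where
  "psd_mats = {A. square_mat A \<and> mat_adjoint A = A \<and>
     (\<forall>v \<in> carrier_vec (dim_row A). 0 \<le> (A *\<^sub>v v) \<bullet>c v)}"

text \<open>Only strictly positive factors are required, so a cone may or may not contain the zero
  matrix of a given size.\<close>

definition matrix_cone :: "complex mat set \<Rightarrow> bool" where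
  "matrix_cone K \<longleftrightarrow>
     (\<forall>A \<in> K. square_mat A) \<and>
     (\<forall>A \<in> K. \<forall>c::real. 0 < c \<longrightarrow> complex_of_real c \<cdot>\<^sub>m A \<in> K) \<and>
     (\<forall>A \<in> K. \<forall>B \<in> K. dim_row A = dim_row B \<longrightarrow> A + B \<in> K)"

datatype vertex_rel = Equal | Adjacent | Distinct_Nonadjacent

definition rel :: "'a pair_pre_digraph \<Rightarrow> 'a \<Rightarrow> 'a \<Rightarrow> vertex_rel" where
  "rel G x y =
     (if x = y then Equal else if (x, y) \<in> parcs G then Adjacent else Distinct_Nonadjacent)"

definition iso_cone ::
    "complex mat set \<Rightarrow> ('a \<times> 'b \<Rightarrow> nat) \<Rightarrow> 'a pair_pre_digraph \<Rightarrow> 'b pair_pre_digraph \<Rightarrow> bool" where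
  "iso_cone K \<iota> G H \<longleftrightarrow>
     (\<exists>M \<in> K. M \<in> carrier_mat (card (pverts G \<times> pverts H)) (card (pverts G \<times> pverts H)) \<and>
        (\<forall>g \<in> pverts G. \<forall>g' \<in> pverts G.
           (\<Sum>h \<in> pverts H. \<Sum>h' \<in> pverts H. M $$ (\<iota> (g, h), \<iota> (g', h'))) = 1) \<and>
        (\<forall>h \<in> pverts H. \<forall>h' \<in> pverts H.
           (\<Sum>g \<in> pverts G. \<Sum>g' \<in> pverts G. M $$ (\<iota> (g, h), \<iota> (g', h'))) = 1) \<and>
        (\<forall>g \<in> pverts G. \<forall>g' \<in> pverts G. \<forall>h \<in> pverts H. \<forall>h' \<in> pverts H.
           rel G g g' \<noteq> rel H h h' \<longrightarrow> M $$ (\<iota> (g, h), \<iota> (g', h')) = 0))"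

definition iso_product ::
    "'a pair_pre_digraph \<Rightarrow> 'b pair_pre_digraph \<Rightarrow> ('a \<times> 'b) pair_pre_digraph"
    (infixl "\<diamond>" 70) where
  "G \<diamond> H = \<lparr> pverts = pverts G \<times> pverts H,
     parcs = {((g, h), (g', h')) | g h g' h'.
       g \<in> pverts G \<and> g' \<in> pverts G \<and> h \<in> pverts H \<and> h' \<in> pverts H \<and>
       rel G g g' \<noteq> rel H h h'} \<rparr>"

definition theta_feasible ::
    "complex mat set \<Rightarrow> ('v \<Rightarrow> nat) \<Rightarrow> 'v pair_pre_digraph \<Rightarrow> complex mat set" where
  "theta_feasible K \<iota> F = {M \<in> K. M \<in> carrier_mat (card (pverts F)) (card (pverts F)) \<and>
     trace_mat M = 1 \<and>
     (\<forall>u \<in> pverts F. \<forall>u' \<in> pverts F. (u, u') \<in> parcs F \<longrightarrow> M $$ (\<iota> u, \<iota> u') = 0)}"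

text \<open>For Hermitian \<open>M\<close> the trace of \<open>M J\<close> is real, so taking the real part loses nothing.\<close>

definition theta_objective :: "complex mat \<Rightarrow> ereal" where
  "theta_objective M = ereal (Re (trace_mat (M * all_ones_mat (dim_row M))))"

text \<open>The supremum is taken in \<^typ>\<open>ereal\<close>, where it is meaningful also if the problem is
  infeasible (value \<open>-\<infinity>\<close>) or unbounded.\<close>

definition theta ::
    "complex mat set \<Rightarrow> ('v \<Rightarrow> nat) \<Rightarrow> 'v pair_pre_digraph \<Rightarrow> ereal" where
  "theta K \<iota> F = (SUP M \<in> theta_feasible K \<iota> F. theta_objective M)"

definition theta_attained ::
    "complex mat set \<Rightarrow> ('v \<Rightarrow> nat) \<Rightarrow> 'v pair_pre_digraph \<Rightarrow> bool" where
  "theta_attained K \<iota> F \<longleftrightarrow> (\<exists>M \<in> theta_feasible K \<iota> F. theta_objective M = theta K \<iota> F)"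

end

theory Submission
  imports Defs
begin

text \<open>
  Write \<open>B\<close> for a positive semidefinite matrix indexed by \<open>V\<^sub>G \<times> V\<^sub>H\<close>. Summing over the
  \<open>H\<close>-coordinates gives a positive semidefinite matrix \<open>A\<close> indexed by \<open>V\<^sub>G\<close> with the same entry sum,
  and with the same trace because \<open>B\<close> vanishes at \<open>((g, h), (g, h'))\<close> for \<open>h \<noteq> h'\<close>. Evaluating the
  form \<open>A\<close> at the differences \<open>e\<^sub>g - e\<^sub>g\<^sub>'\<close> and summing shows that the entry sum is at most \<open>|V\<^sub>G|\<close> times
  the trace; in the equality case every \<open>e\<^sub>g - e\<^sub>g\<^sub>'\<close> is isotropic, so by Cauchy-Schwarz it lies in
  the radical and \<open>A\<close> is constant. The same holds with the roles of \<open>G\<close> and \<open>H\<close> exchanged, and the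
  two problems are related by scaling with \<open>|V\<^sub>G|\<close>.
\<close>

section \<open>Hermitian forms on finite index sets and their isotropic vectors\<close>

text \<open>Kernels on an arbitrary index set stand in for matrices, so that summing out or
  exchanging coordinates needs no numbering of \<open>V\<close>. The form is conjugate-linear in its
  first argument.\<close>

definition ker_form :: "'v set \<Rightarrow> ('v \<Rightarrow> 'v \<Rightarrow> complex) \<Rightarrow> ('v \<Rightarrow> complex) \<Rightarrow> ('v \<Rightarrow> complex) \<Rightarrow> complex"
  where "ker_form V A f g = (\<Sum>p\<in>V. \<Sum>q\<in>V. cnj (f p) * A p q * g q)"

text \<open>Hermitian symmetry makes \<open>ker_form V A f f\<close> real, so bounding its real part
  is enough.\<close>

definition psd_kernel :: "'v set \<Rightarrow> ('v \<Rightarrow> 'v \<Rightarrow> complex) \<Rightarrow> bool" where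
  "psd_kernel V A \<longleftrightarrow> finite V \<and> (\<forall>p\<in>V. \<forall>q\<in>V. A p q = cnj (A q p)) \<and> (\<forall>f. 0 \<le> Re (ker_form V A f f))"

lemma psd_kernelD:
  assumes "psd_kernel V A"
  shows "finite V" and "\<And>p q. p \<in> V \<Longrightarrow> q \<in> V \<Longrightarrow> A p q = cnj (A q p)"
    and "0 \<le> Re (ker_form V A f f)"
  using assms unfolding psd_kernel_def by blast+

lemma ker_form_add_left: "ker_form V A (\<lambda>p. f p + c * g p) k = ker_form V A f k + cnj c * ker_form V A g k"
  by (simp add: ker_form_def sum.distrib sum_distrib_left algebra_simps)

lemma ker_form_add_right: "ker_form V A k (\<lambda>p. f p + c * g p) = ker_form V A k f + c * ker_form V A k g"
  by (simp add: ker_form_def sum.distrib sum_distrib_left algebra_simps)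

lemma ker_form_cnj:
  assumes "psd_kernel V A"
  shows "ker_form V A g f = cnj (ker_form V A f g)"
proof -
  have "ker_form V A g f = (\<Sum>p\<in>V. \<Sum>q\<in>V. cnj (cnj (f q) * A q p * g p))"
    unfolding ker_form_def
    by (intro sum.cong refl) (simp add: psd_kernelD(2)[OF assms, symmetric])
  also have "\<dots> = cnj (ker_form V A f g)"
    unfolding ker_form_def cnj_sum by (rule sum.swap)
  finally show ?thesis .
qed

text \<open>Degenerate Cauchy-Schwarz: moving \<open>g\<close> along an isotropic \<open>f\<close>
  leaves no quadratic term, so the form changes affinely in the step size. An affine function that
  stays nonnegative has slope zero.\<close>

lemma ker_form_isotropic:
  assumes A: "psd_kernel V A" and f0: "Re (ker_form V A f f) = 0"
  shows "ker_form V A f g = 0"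
proof (rule ccontr)
  define z where "z = ker_form V A f g"
  assume "ker_form V A f g \<noteq> 0"
  then have z: "cmod z ^ 2 > 0" by (simp add: z_def)
  have Im0: "Im (ker_form V A f f) = 0"
    using ker_form_cnj[OF A, of f f] by (metis Reals_cnj_iff complex_is_Real_iff)
  then have ff: "ker_form V A f f = 0" using f0 by (simp add: complex_eq_iff)
  have ineq: "0 \<le> Re (ker_form V A g g) - 2 * s * cmod z ^ 2" for s :: real
  proof -
    \<comment> \<open>This direction makes both cross terms equal to
      \<open>- s * cmod z ^ 2\<close>.\<close>
    define t where "t = - (of_real s * z)"
    have "ker_form V A (\<lambda>p. g p + t * f p) (\<lambda>p. g p + t * f p)
        = ker_form V A g g + t * cnj z + cnj t * z"
      by (simp add: ker_form_add_left ker_form_add_right ff z_def ker_form_cnj[OF A, of g f] algebra_simps)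
    moreover have "Re (t * cnj z + cnj t * z) = - 2 * s * cmod z ^ 2"
      unfolding cmod_power2 by (simp add: t_def power2_eq_square algebra_simps)
    ultimately show ?thesis
      using psd_kernelD(3)[OF A, of "\<lambda>p. g p + t * f p"] by simp
  qed
  show False
    \<comment> \<open>For this \<open>s\<close> the right-hand side of \<open>ineq\<close> is
      -1.\<close>
    using ineq[of "(Re (ker_form V A g g) + 1) / (2 * cmod z ^ 2)"] z by simp
qed

section \<open>Entry sum against trace, and the equality case\<close>

abbreviation (input) basis_fun :: "'v \<Rightarrow> 'v \<Rightarrow> complex" where
  "basis_fun a \<equiv> (\<lambda>p. if p = a then 1 else 0)"

lemma ker_form_basis:
  assumes "finite V" "a \<in> V" "b \<in> V"
  shows "ker_form V A (basis_fun a) (basis_fun b) = A a b"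
proof -
  have "ker_form V A (basis_fun a) (basis_fun b)
      = (\<Sum>p\<in>V. if p = a then (\<Sum>q\<in>V. if q = b then A p q else 0) else 0)"
    unfolding ker_form_def by (intro sum.cong refl) (auto intro!: sum.cong)
  then show ?thesis using assms by simp
qed

text \<open>The difference of basis vectors is written with the factor \<open>(-1)\<close> so that
  \<open>ker_form_add_left\<close> and \<open>ker_form_add_right\<close> rewrite it.\<close>

lemma ker_form_diff:
  assumes "finite V" "a \<in> V" "b \<in> V"
  defines "d \<equiv> \<lambda>p. basis_fun a p + (-1) * basis_fun b p"
  shows "ker_form V A d d = A a a + A b b - A a b - A b a"
    and "c \<in> V \<Longrightarrow> ker_form V A d (basis_fun c) = A a c - A b c"
  unfolding d_def ker_form_add_left ker_form_add_right
  using assms(1-3) by (simp_all add: ker_form_basis)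

lemma psd_kernel_diff_nonneg:
  assumes A: "psd_kernel V A" and ab: "a \<in> V" "b \<in> V"
  shows "0 \<le> Re (A a a + A b b - A a b - A b a)"
  using psd_kernelD(3)[OF A, of "\<lambda>p. basis_fun a p + (-1) * basis_fun b p"]
  by (simp only: ker_form_diff(1)[OF psd_kernelD(1)[OF A] ab])

text \<open>With n = \<open>card V\<close>, this expresses n I - J as the Laplacian of the complete
  graph on \<open>V\<close>. The factor 2 arises because ordered pairs are summed.\<close>

lemma sum_diff_pairs:
  fixes A :: "'v \<Rightarrow> 'v \<Rightarrow> complex"
  shows "(\<Sum>a\<in>V. \<Sum>b\<in>V. Re (A a a + A b b - A a b - A b a))
    = 2 * (of_nat (card V) * Re (\<Sum>a\<in>V. A a a) - Re (\<Sum>a\<in>V. \<Sum>b\<in>V. A a b))"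
proof -
  have "(\<Sum>a\<in>V. \<Sum>b\<in>V. Re (A b a)) = (\<Sum>a\<in>V. \<Sum>b\<in>V. Re (A a b))"
    by (rule sum.swap)
  then show ?thesis
    by (simp add: sum.distrib sum_subtractf sum_negf sum_distrib_left[symmetric])
qed

lemma psd_kernel_sum_le:
  assumes A: "psd_kernel V A"
  shows "Re (\<Sum>a\<in>V. \<Sum>b\<in>V. A a b) \<le> of_nat (card V) * Re (\<Sum>a\<in>V. A a a)"
proof -
  have "0 \<le> (\<Sum>a\<in>V. \<Sum>b\<in>V. Re (A a a + A b b - A a b - A b a))"
    by (intro sum_nonneg psd_kernel_diff_nonneg[OF A])
  then show ?thesis unfolding sum_diff_pairs by simp
qed

text \<open>Equality makes a sum of nonnegative terms vanish, hence each term: all differences of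
  basis vectors are isotropic. Lying in the radical, they force all rows to agree.\<close>

lemma psd_kernel_sum_eq_imp_const:
  assumes A: "psd_kernel V A"
    and eq: "Re (\<Sum>a\<in>V. \<Sum>b\<in>V. A a b) = of_nat (card V) * Re (\<Sum>a\<in>V. A a a)"
    and V: "a \<in> V" "b \<in> V" "c \<in> V" "d \<in> V"
  shows "A a b = A c d"
proof -
  note fin = psd_kernelD(1)[OF A]
  note nonneg = psd_kernel_diff_nonneg[OF A]
  have "(\<Sum>a\<in>V. \<Sum>b\<in>V. Re (A a a + A b b - A a b - A b a)) = 0"
    unfolding sum_diff_pairs using eq by simp
  then have row_sum: "(\<Sum>b\<in>V. Re (A a a + A b b - A a b - A b a)) = 0" if "a \<in> V" for a
    using that by (subst (asm) sum_nonneg_eq_0_iff[OF fin]) (blast intro: sum_nonneg nonneg)+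
  have zero: "Re (A a a + A b b - A a b - A b a) = 0" if "a \<in> V" "b \<in> V" for a b
    using iffD1[OF sum_nonneg_eq_0_iff[OF fin nonneg[OF that(1)]] row_sum[OF that(1)]] that(2)
    by blast
  have row: "A a e = A b e" if "a \<in> V" "b \<in> V" "e \<in> V" for a b e
  proof -
    let ?d = "\<lambda>p. basis_fun a p + (-1) * basis_fun b p"
    have "Re (ker_form V A ?d ?d) = 0"
      using zero[OF that(1,2)] by (simp only: ker_form_diff(1)[OF fin that(1,2)])
    from ker_form_isotropic[OF A this, of "basis_fun e"] show ?thesis
      by (simp only: ker_form_diff(2)[OF fin that]) simp
  qed
  \<comment> \<open>Equal rows settle the first index; Hermitian symmetry turns the second index
    into a row index.\<close>
  have "A a b = A c b" using V by (intro row)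
  also have "\<dots> = cnj (A b c)" using V by (intro psd_kernelD(2)[OF A])
  also have "A b c = A d c" using V by (intro row)
  also have "cnj \<dots> = A c d" using V by (intro psd_kernelD(2)[OF A, symmetric])
  finally show ?thesis .
qed

section \<open>Marginals, relabelling, and the passage from matrices to kernels\<close>

text \<open>The marginal form at \<open>f\<close> is the form of \<open>B\<close> at the lift of
  \<open>f\<close> that is constant along \<open>W\<close>.\<close>

lemma psd_kernel_marginal:
  assumes B: "psd_kernel (V \<times> W) B" and "finite V" "finite W"
  shows "psd_kernel V (\<lambda>g g'. \<Sum>h\<in>W. \<Sum>h'\<in>W. B (g, h) (g', h'))"
  unfolding psd_kernel_def
proof (intro conjI ballI allI)
  show "finite V" by fact
next
  fix g g' assume g: "g \<in> V" "g' \<in> V"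
  have "(\<Sum>h\<in>W. \<Sum>h'\<in>W. B (g, h) (g', h')) = (\<Sum>h\<in>W. \<Sum>h'\<in>W. cnj (B (g', h') (g, h)))"
    using g by (intro sum.cong refl psd_kernelD(2)[OF B]) auto
  also have "\<dots> = cnj (\<Sum>h'\<in>W. \<Sum>h\<in>W. B (g', h') (g, h))"
    unfolding cnj_sum by (rule sum.swap)
  finally show "(\<Sum>h\<in>W. \<Sum>h'\<in>W. B (g, h) (g', h')) = cnj (\<Sum>h\<in>W. \<Sum>h'\<in>W. B (g', h) (g, h'))" .
next
  fix f :: "'a \<Rightarrow> complex"
  have "ker_form V (\<lambda>g g'. \<Sum>h\<in>W. \<Sum>h'\<in>W. B (g, h) (g', h')) f f
      = (\<Sum>g\<in>V. \<Sum>g'\<in>V. \<Sum>h\<in>W. \<Sum>h'\<in>W. cnj (f g) * B (g, h) (g', h') * f g')"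
    by (simp add: ker_form_def sum_distrib_left sum_distrib_right)
  also have "\<dots> = (\<Sum>g\<in>V. \<Sum>h\<in>W. \<Sum>g'\<in>V. \<Sum>h'\<in>W. cnj (f g) * B (g, h) (g', h') * f g')"
    by (intro sum.cong refl sum.swap)
  also have "\<dots> = ker_form (V \<times> W) B (\<lambda>p. f (fst p)) (\<lambda>p. f (fst p))"
    by (simp add: ker_form_def sum.cartesian_product' split_def)
  finally show "0 \<le> Re (ker_form V (\<lambda>g g'. \<Sum>h\<in>W. \<Sum>h'\<in>W. B (g, h) (g', h')) f f)"
    using psd_kernelD(3)[OF B] by simp
qed

text \<open>Transporting \<open>f\<close> along the inverse of \<open>\<pi>\<close> preserves the
  value of the form. This serves both the labelling by natural numbers and the exchange of the two
  coordinates.\<close>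

lemma psd_kernel_reindex:
  assumes "psd_kernel U B" and "bij_betw \<pi> V U"
  shows "psd_kernel V (\<lambda>p q. B (\<pi> p) (\<pi> q))"
  unfolding psd_kernel_def
proof (intro conjI ballI allI)
  show "finite V" using assms bij_betw_finite psd_kernelD(1) by blast
next
  fix p q assume "p \<in> V" "q \<in> V"
  then show "B (\<pi> p) (\<pi> q) = cnj (B (\<pi> q) (\<pi> p))"
    using assms by (intro psd_kernelD(2)) (auto simp: bij_betw_def)
next
  fix f :: "'b \<Rightarrow> complex"
  let ?\<sigma> = "the_inv_into V \<pi>"
  have "?\<sigma> (\<pi> p) = p" if "p \<in> V" for p
    using assms(2) that by (simp add: bij_betw_def the_inv_into_f_f)
  \<comment> \<open>Each \<open>f p\<close> is rewritten through \<open>\<pi> p\<close>, so that the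
    summands have the shape needed for reindexing.\<close>
  then have "ker_form V (\<lambda>p q. B (\<pi> p) (\<pi> q)) f f
      = (\<Sum>p\<in>V. \<Sum>q\<in>V. cnj (f (?\<sigma> (\<pi> p))) * B (\<pi> p) (\<pi> q) * f (?\<sigma> (\<pi> q)))"
    by (simp add: ker_form_def)
  also have "\<dots> = (\<Sum>p\<in>V. \<Sum>q\<in>U. cnj (f (?\<sigma> (\<pi> p))) * B (\<pi> p) q * f (?\<sigma> q))"
    by (intro sum.cong refl sum.reindex_bij_betw[OF assms(2)])
  also have "\<dots> = ker_form U B (f \<circ> ?\<sigma>) (f \<circ> ?\<sigma>)"
    unfolding ker_form_def comp_def
    by (rule sum.reindex_bij_betw[OF assms(2), where g = "\<lambda>p. \<Sum>q\<in>U. cnj (f (?\<sigma> p)) * B p q * f (?\<sigma> q)"])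
  finally show "0 \<le> Re (ker_form V (\<lambda>p q. B (\<pi> p) (\<pi> q)) f f)"
    using psd_kernelD(3)[OF assms(1)] by simp
qed

lemma psd_mats_imp_psd_kernel:
  assumes "M \<in> psd_mats" and "M \<in> carrier_mat n n"
  shows "psd_kernel {..<n} (\<lambda>i j. M $$ (i, j))"
  unfolding psd_kernel_def
proof (intro conjI ballI allI)
  fix i j assume ij: "i \<in> {..<n}" "j \<in> {..<n}"
  have "M $$ (i, j) = mat_adjoint M $$ (i, j)"
    using assms(1) by (simp add: psd_mats_def)
  also have "\<dots> = cnj (M $$ (j, i))"
    using ij assms(2) by (simp add: mat_adjoint_def mat_of_rows_def)
  finally show "M $$ (i, j) = cnj (M $$ (j, i))" .
next
  fix f :: "nat \<Rightarrow> complex"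
  have "0 \<le> (M *\<^sub>v vec n f) \<bullet>c vec n f"
    using assms by (auto simp: psd_mats_def)
  moreover have "(M *\<^sub>v vec n f) \<bullet>c vec n f = ker_form {..<n} (\<lambda>i j. M $$ (i, j)) f f"
    using assms(2)
    by (auto simp: scalar_prod_def ker_form_def sum_distrib_right lessThan_atLeast0
        intro!: sum.cong)
  ultimately show "0 \<le> Re (ker_form {..<n} (\<lambda>i j. M $$ (i, j)) f f)"
    by (simp add: less_eq_complex_def)
qed simp

section \<open>Entry sum and trace under marginalisation\<close>

lemma marginal_entry_sum:
  fixes B :: "'a \<times> 'b \<Rightarrow> 'a \<times> 'b \<Rightarrow> complex"
  shows "(\<Sum>g\<in>V. \<Sum>g'\<in>V. \<Sum>h\<in>W. \<Sum>h'\<in>W. B (g, h) (g', h')) = (\<Sum>p\<in>V \<times> W. \<Sum>q\<in>V \<times> W. B p q)"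
proof -
  have "(\<Sum>g\<in>V. \<Sum>g'\<in>V. \<Sum>h\<in>W. \<Sum>h'\<in>W. B (g, h) (g', h'))
      = (\<Sum>g\<in>V. \<Sum>h\<in>W. \<Sum>g'\<in>V. \<Sum>h'\<in>W. B (g, h) (g', h'))"
    by (intro sum.cong refl sum.swap)
  then show ?thesis by (simp add: sum.cartesian_product')
qed

text \<open>A diagonal entry of the marginal sums a whole block of \<open>B\<close>; since the block
  is diagonal, only its trace remains.\<close>

lemma marginal_trace:
  fixes B :: "'a \<times> 'b \<Rightarrow> 'a \<times> 'b \<Rightarrow> complex"
  assumes "finite W"
    and "\<And>g h h'. g \<in> V \<Longrightarrow> h \<in> W \<Longrightarrow> h' \<in> W \<Longrightarrow> h \<noteq> h' \<Longrightarrow> B (g, h) (g, h') = 0"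
  shows "(\<Sum>g\<in>V. \<Sum>h\<in>W. \<Sum>h'\<in>W. B (g, h) (g, h')) = (\<Sum>p\<in>V \<times> W. B p p)"
proof -
  have "(\<Sum>h'\<in>W. B (g, h) (g, h')) = B (g, h) (g, h)" if "g \<in> V" "h \<in> W" for g h
    using assms that by (subst sum.remove[of W h]) (auto intro!: sum.neutral)
  then show ?thesis by (simp add: sum.cartesian_product')
qed

lemma marginal_sum_le:
  assumes B: "psd_kernel (V \<times> W) B" and fin: "finite V" "finite W"
    and zero: "\<And>g h h'. g \<in> V \<Longrightarrow> h \<in> W \<Longrightarrow> h' \<in> W \<Longrightarrow> h \<noteq> h' \<Longrightarrow> B (g, h) (g, h') = 0"
    and tr: "(\<Sum>p\<in>V \<times> W. B p p) = 1"
  shows "Re (\<Sum>p\<in>V \<times> W. \<Sum>q\<in>V \<times> W. B p q) \<le> real (card V)"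
  using psd_kernel_sum_le[OF psd_kernel_marginal[OF B fin]]
    marginal_entry_sum[of B W V] marginal_trace[of W V B, OF fin(2) zero] tr by simp

text \<open>Equality in the entry-sum bound makes the marginal constant, and trace 1 then fixes the
  constant as 1 / \<open>card V\<close>. The product form is what the later rescaling uses.\<close>

lemma marginal_eq_const:
  assumes B: "psd_kernel (V \<times> W) B" and fin: "finite V" "finite W"
    and zero: "\<And>g h h'. g \<in> V \<Longrightarrow> h \<in> W \<Longrightarrow> h' \<in> W \<Longrightarrow> h \<noteq> h' \<Longrightarrow> B (g, h) (g, h') = 0"
    and tr: "(\<Sum>p\<in>V \<times> W. B p p) = 1"
    and eq: "Re (\<Sum>p\<in>V \<times> W. \<Sum>q\<in>V \<times> W. B p q) = real (card V)"
    and g: "g \<in> V" "g' \<in> V"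
  shows "of_nat (card V) * (\<Sum>h\<in>W. \<Sum>h'\<in>W. B (g, h) (g', h')) = 1"
proof -
  let ?A = "\<lambda>g g'. \<Sum>h\<in>W. \<Sum>h'\<in>W. B (g, h) (g', h')"
  have trA: "(\<Sum>a\<in>V. ?A a a) = 1" using marginal_trace[of W V B, OF fin(2) zero] tr by simp
  have "Re (\<Sum>a\<in>V. \<Sum>b\<in>V. ?A a b) = of_nat (card V) * Re (\<Sum>a\<in>V. ?A a a)"
    unfolding trA marginal_entry_sum using eq by simp
  then have "?A a a = ?A g g'" if "a \<in> V" for a
    using psd_kernel_sum_eq_imp_const[OF psd_kernel_marginal[OF B fin]] g that by blast
  then have "(\<Sum>a\<in>V. ?A a a) = of_nat (card V) * ?A g g'" by simp
  then show ?thesis using trA by simp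
qed

section \<open>The theta problem on the isomorphism product\<close>

lemma trace_mat_labelled:
  assumes "M \<in> carrier_mat n n" "bij_betw \<iota> P {..<n}"
  shows "trace_mat M = (\<Sum>p\<in>P. M $$ (\<iota> p, \<iota> p))"
  using assms(1) sum.reindex_bij_betw[OF assms(2), of "\<lambda>i. M $$ (i, i)"]
  by (simp add: trace_mat_def)

lemma theta_objective_labelled:
  assumes "M \<in> carrier_mat n n" "bij_betw \<iota> P {..<n}"
  shows "theta_objective M = ereal (Re (\<Sum>p\<in>P. \<Sum>q\<in>P. M $$ (\<iota> p, \<iota> q)))"
proof -
  have "trace_mat (M * all_ones_mat n) = (\<Sum>i<n. \<Sum>j<n. M $$ (i, j))"
    using assms(1)
    by (auto simp: trace_mat_def all_ones_mat_def scalar_prod_def lessThan_atLeast0 intro!: sum.cong)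
  also have "\<dots> = (\<Sum>p\<in>P. \<Sum>j<n. M $$ (\<iota> p, j))"
    by (rule sum.reindex_bij_betw[OF assms(2), symmetric])
  also have "\<dots> = (\<Sum>p\<in>P. \<Sum>q\<in>P. M $$ (\<iota> p, \<iota> q))"
    by (intro sum.cong refl sum.reindex_bij_betw[OF assms(2), symmetric])
  finally show ?thesis using assms(1) by (simp add: theta_objective_def)
qed

text \<open>The arcs of the product are exactly the positions where \<open>iso_cone\<close> demands
  zeros, so the two problems share their zero pattern and differ only in normalisation.\<close>

lemma theta_feasible_iso_product_iff:
  assumes "bij_betw \<iota> (pverts G \<times> pverts H) {..<card (pverts G \<times> pverts H)}"
  shows "M \<in> theta_feasible K \<iota> (G \<diamond> H) \<longleftrightarrow>
    M \<in> K \<and> M \<in> carrier_mat (card (pverts G \<times> pverts H)) (card (pverts G \<times> pverts H)) \<and>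
    (\<Sum>p\<in>pverts G \<times> pverts H. M $$ (\<iota> p, \<iota> p)) = 1 \<and>
    (\<forall>g \<in> pverts G. \<forall>g' \<in> pverts G. \<forall>h \<in> pverts H. \<forall>h' \<in> pverts H.
       rel G g g' \<noteq> rel H h h' \<longrightarrow> M $$ (\<iota> (g, h), \<iota> (g', h')) = 0)"
  using trace_mat_labelled[OF _ assms]
  by (auto simp: theta_feasible_def iso_product_def)

text \<open>Exactly one side is \<open>Equal\<close>. The two orientations give the zeros needed for
  the marginals on \<open>G\<close> and on \<open>H\<close>.\<close>

lemma rel_same_neq: "h \<noteq> h' \<Longrightarrow> rel G g g \<noteq> rel H h h'" "h \<noteq> h' \<Longrightarrow> rel H h h' \<noteq> rel G g g"
  by (auto simp: rel_def)

lemma psd_mats_imp_labelled_psd_kernel: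
  assumes "M \<in> psd_mats" "M \<in> carrier_mat n n" "bij_betw \<iota> P {..<n}"
  shows "psd_kernel P (\<lambda>p q. M $$ (\<iota> p, \<iota> q))"
  using psd_kernel_reindex[OF psd_mats_imp_psd_kernel[OF assms(1,2)] assms(3)] .

text \<open>Each feasible matrix has trace 1 and is bounded through its marginal on
  \<open>G\<close>.\<close>

lemma theta_iso_product_le:
  assumes fin: "finite (pverts G)" "finite (pverts H)" and K: "K \<subseteq> psd_mats"
    and \<iota>: "bij_betw \<iota> (pverts G \<times> pverts H) {..<card (pverts G \<times> pverts H)}"
  shows "theta K \<iota> (G \<diamond> H) \<le> ereal (real (card (pverts G)))"
  unfolding theta_def
proof (rule SUP_least)
  fix M assume M: "M \<in> theta_feasible K \<iota> (G \<diamond> H)"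
  note M' = M[unfolded theta_feasible_iso_product_iff[OF \<iota>]]
  have "psd_kernel (pverts G \<times> pverts H) (\<lambda>p q. M $$ (\<iota> p, \<iota> q))"
    using M' K \<iota> by (intro psd_mats_imp_labelled_psd_kernel) auto
  from marginal_sum_le[OF this fin] M'
  show "theta_objective M \<le> ereal (real (card (pverts G)))"
    by (subst theta_objective_labelled[OF _ \<iota>]) (auto simp: rel_same_neq)
qed

section \<open>Rescaling between the two problems\<close>

lemma matrix_cone_smult: "matrix_cone K \<Longrightarrow> A \<in> K \<Longrightarrow> 0 < c \<Longrightarrow> complex_of_real c \<cdot>\<^sub>m A \<in> K"
  by (simp add: matrix_cone_def)

text \<open>With n = |V_G|, the marginal of \<open>M\<close> on \<open>G\<close> is all ones, so
  \<open>M\<close> has trace n and entry sum n^2; dividing by n yields trace 1 and objective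
  n.\<close>

lemma iso_cone_imp_feasible:
  assumes fin: "finite (pverts G)" "finite (pverts H)" and ne: "pverts G \<noteq> {}"
    and cone: "matrix_cone K"
    and \<iota>: "bij_betw \<iota> (pverts G \<times> pverts H) {..<card (pverts G \<times> pverts H)}"
    and iso: "iso_cone K \<iota> G H"
  shows "card (pverts G) = card (pverts H)"
    and "\<exists>M \<in> theta_feasible K \<iota> (G \<diamond> H). theta_objective M = ereal (real (card (pverts G)))"
proof -
  let ?V = "pverts G" and ?W = "pverts H"
  let ?n = "card ?V" and ?N = "card (?V \<times> ?W)"
  from iso obtain M where M: "M \<in> K" "M \<in> carrier_mat ?N ?N"
    and sG: "\<And>g g'. g \<in> ?V \<Longrightarrow> g' \<in> ?V \<Longrightarrow> (\<Sum>h\<in>?W. \<Sum>h'\<in>?W. M $$ (\<iota> (g, h), \<iota> (g', h'))) = 1"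
    and sH: "\<And>h h'. h \<in> ?W \<Longrightarrow> h' \<in> ?W \<Longrightarrow> (\<Sum>g\<in>?V. \<Sum>g'\<in>?V. M $$ (\<iota> (g, h), \<iota> (g', h'))) = 1"
    and z: "\<And>g g' h h'. g \<in> ?V \<Longrightarrow> g' \<in> ?V \<Longrightarrow> h \<in> ?W \<Longrightarrow> h' \<in> ?W \<Longrightarrow> rel G g g' \<noteq> rel H h h' \<Longrightarrow>
      M $$ (\<iota> (g, h), \<iota> (g', h')) = 0"
    unfolding iso_cone_def by blast
  let ?B = "\<lambda>p q. M $$ (\<iota> p, \<iota> q)"
  have total: "(\<Sum>p\<in>?V \<times> ?W. \<Sum>q\<in>?V \<times> ?W. ?B p q) = of_nat (?n * ?n)"
    using marginal_entry_sum[of ?B ?W ?V] sG by simp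
  \<comment> \<open>Double counting: the entry sum is |V_G|^2 when grouped by \<open>G\<close> and
    |V_H|^2 when grouped by \<open>H\<close>.\<close>
  have "(\<Sum>g\<in>?V. \<Sum>g'\<in>?V. \<Sum>h\<in>?W. \<Sum>h'\<in>?W. ?B (g, h) (g', h'))
      = (\<Sum>h\<in>?W. \<Sum>h'\<in>?W. \<Sum>g\<in>?V. \<Sum>g'\<in>?V. ?B (g, h) (g', h'))"
  proof -
    have "(\<Sum>g\<in>?V. \<Sum>g'\<in>?V. \<Sum>h\<in>?W. \<Sum>h'\<in>?W. ?B (g, h) (g', h'))
       = (\<Sum>g\<in>?V. \<Sum>h\<in>?W. \<Sum>g'\<in>?V. \<Sum>h'\<in>?W. ?B (g, h) (g', h'))"
      by (intro sum.cong refl sum.swap)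
    also have "\<dots> = (\<Sum>h\<in>?W. \<Sum>g\<in>?V. \<Sum>h'\<in>?W. \<Sum>g'\<in>?V. ?B (g, h) (g', h'))"
      by (subst sum.swap) (intro sum.cong refl sum.swap)
    also have "\<dots> = (\<Sum>h\<in>?W. \<Sum>h'\<in>?W. \<Sum>g\<in>?V. \<Sum>g'\<in>?V. ?B (g, h) (g', h'))"
      by (intro sum.cong refl sum.swap)
    finally show ?thesis .
  qed
  then have "of_nat (?n * ?n) = (of_nat (card ?W * card ?W) :: complex)"
    using sG sH by simp
  then have "?n * ?n = card ?W * card ?W"
    by (simp only: of_nat_eq_iff)
  then show "?n = card ?W" by (metis power2_eq_square power2_eq_iff_nonneg le0)
  have n0: "?n > 0" using fin ne by (simp add: card_gt_0_iff)
  \<comment> \<open>Each of the n diagonal entries of the marginal on \<open>G\<close> equals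
    1.\<close>
  have trace: "(\<Sum>p\<in>?V \<times> ?W. ?B p p) = of_nat ?n"
    using marginal_trace[of ?W ?V ?B] fin sG z by (simp add: rel_same_neq)
  let ?M = "complex_of_real (1 / real ?n) \<cdot>\<^sub>m M"
  have \<iota>_less: "\<iota> p < ?N" if "p \<in> ?V \<times> ?W" for p
    using \<iota> that by (auto simp: bij_betw_def)
  have ent: "?M $$ (\<iota> p, \<iota> q) = ?B p q / of_nat ?n" if "p \<in> ?V \<times> ?W" "q \<in> ?V \<times> ?W" for p q
    using \<iota>_less[OF that(1)] \<iota>_less[OF that(2)] M(2) by (simp add: divide_inverse)
  have "?M \<in> K" using n0 by (intro matrix_cone_smult[OF cone M(1)]) simp
  moreover have car: "?M \<in> carrier_mat ?N ?N" using M(2) by simp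
  moreover have "(\<Sum>p\<in>?V \<times> ?W. ?M $$ (\<iota> p, \<iota> p)) = 1"
    using n0 trace by (simp only: ent sum_divide_distrib[symmetric] cong: sum.cong) simp
  moreover have "?M $$ (\<iota> (g, h), \<iota> (g', h')) = 0"
    if "g \<in> ?V" "g' \<in> ?V" "h \<in> ?W" "h' \<in> ?W" "rel G g g' \<noteq> rel H h h'" for g g' h h'
    using that ent[of "(g, h)" "(g', h')"] z[OF that] by simp
  ultimately have "?M \<in> theta_feasible K \<iota> (G \<diamond> H)"
    unfolding theta_feasible_iso_product_iff[OF \<iota>] by blast
  moreover have "theta_objective ?M = ereal (real ?n)"
  proof -
    have "(\<Sum>p\<in>?V \<times> ?W. \<Sum>q\<in>?V \<times> ?W. ?M $$ (\<iota> p, \<iota> q)) = of_nat (?n * ?n) / of_nat ?n"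
      by (simp only: ent sum_divide_distrib[symmetric] total cong: sum.cong)
    also have "\<dots> = of_nat ?n" using n0 by simp
    finally show ?thesis by (simp only: theta_objective_labelled[OF car \<iota>]) simp
  qed
  ultimately show "\<exists>M \<in> theta_feasible K \<iota> (G \<diamond> H). theta_objective M = ereal (real ?n)" ..
qed

text \<open>The objective value is extremal for both marginals, so both are constant with entries
  1/n; multiplying \<open>M\<close> by n makes them all ones and keeps the zeros.\<close>

lemma feasible_imp_iso_cone:
  assumes fin: "finite (pverts G)" "finite (pverts H)" and ne: "pverts G \<noteq> {}"
    and cone: "matrix_cone K" and K: "K \<subseteq> psd_mats"
    and \<iota>: "bij_betw \<iota> (pverts G \<times> pverts H) {..<card (pverts G \<times> pverts H)}"
    and card: "card (pverts G) = card (pverts H)"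
    and M: "M \<in> theta_feasible K \<iota> (G \<diamond> H)"
    and obj: "theta_objective M = ereal (real (card (pverts G)))"
  shows "iso_cone K \<iota> G H"
proof -
  let ?V = "pverts G" and ?W = "pverts H"
  let ?n = "card ?V" and ?N = "card (?V \<times> ?W)"
  let ?B = "\<lambda>p q. M $$ (\<iota> p, \<iota> q)"
  \<comment> \<open>\<open>?B\<close> with its coordinates exchanged, so that the marginal lemmas
    apply to \<open>H\<close> as first factor.\<close>
  let ?C = "\<lambda>p q. ?B (prod.swap p) (prod.swap q)"
  have MK: "M \<in> K" and car: "M \<in> carrier_mat ?N ?N"
    and tr: "(\<Sum>p\<in>?V \<times> ?W. ?B p p) = 1"
    and z: "\<And>g g' h h'. g \<in> ?V \<Longrightarrow> g' \<in> ?V \<Longrightarrow> h \<in> ?W \<Longrightarrow> h' \<in> ?W \<Longrightarrow> rel G g g' \<noteq> rel H h h' \<Longrightarrow>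
      ?B (g, h) (g', h') = 0"
    using M unfolding theta_feasible_iso_product_iff[OF \<iota>] by blast+
  have tot: "Re (\<Sum>p\<in>?V \<times> ?W. \<Sum>q\<in>?V \<times> ?W. ?B p q) = real ?n"
    using obj by (simp only: theta_objective_labelled[OF car \<iota>] ereal.inject)
  have B: "psd_kernel (?V \<times> ?W) ?B"
    using MK car K \<iota> by (intro psd_mats_imp_labelled_psd_kernel) auto
  have swap: "bij_betw prod.swap (?W \<times> ?V) (?V \<times> ?W)"
    by (auto simp: bij_betw_def inj_on_def)
  have C: "psd_kernel (?W \<times> ?V) ?C"
    using psd_kernel_reindex[OF B swap] .
  have trC: "(\<Sum>p\<in>?W \<times> ?V. ?C p p) = 1"
    using sum.reindex_bij_betw[OF swap, of "\<lambda>p. ?B p p"] tr by simp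
  have "(\<Sum>p\<in>?W \<times> ?V. \<Sum>q\<in>?W \<times> ?V. ?C p q) = (\<Sum>p\<in>?W \<times> ?V. \<Sum>q\<in>?V \<times> ?W. ?B (prod.swap p) q)"
    by (intro sum.cong refl sum.reindex_bij_betw[OF swap])
  also have "\<dots> = (\<Sum>p\<in>?V \<times> ?W. \<Sum>q\<in>?V \<times> ?W. ?B p q)"
    by (rule sum.reindex_bij_betw[OF swap])
  \<comment> \<open>Here |V_G| = |V_H| enters: the same total is the extremal value for
    \<open>H\<close>.\<close>
  finally have totC: "Re (\<Sum>p\<in>?W \<times> ?V. \<Sum>q\<in>?W \<times> ?V. ?C p q) = real (card ?W)"
    using tot card by simp
  have sG: "of_nat ?n * (\<Sum>h\<in>?W. \<Sum>h'\<in>?W. ?B (g, h) (g', h')) = 1" if "g \<in> ?V" "g' \<in> ?V" for g g'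
    using marginal_eq_const[OF B fin _ tr tot that] z by (simp add: rel_same_neq)
  have sH: "of_nat ?n * (\<Sum>g\<in>?V. \<Sum>g'\<in>?V. ?B (g, h) (g', h')) = 1" if "h \<in> ?W" "h' \<in> ?W" for h h'
    using marginal_eq_const[OF C fin(2,1) _ trC totC that] z card by (simp add: rel_same_neq)
  let ?M = "complex_of_real (real ?n) \<cdot>\<^sub>m M"
  have \<iota>_less: "\<iota> p < ?N" if "p \<in> ?V \<times> ?W" for p
    using \<iota> that by (auto simp: bij_betw_def)
  have ent: "?M $$ (\<iota> (g, h), \<iota> (g', h')) = of_nat ?n * ?B (g, h) (g', h')"
    if "g \<in> ?V" "h \<in> ?W" "g' \<in> ?V" "h' \<in> ?W" for g h g' h'
    using \<iota>_less[of "(g, h)"] \<iota>_less[of "(g', h')"] that car by simp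
  \<comment> \<open>The cone is closed under strictly positive factors, so \<open>G\<close> must
    have a vertex.\<close>
  have "?n > 0" using fin ne by (simp add: card_gt_0_iff)
  then have "?M \<in> K" by (intro matrix_cone_smult[OF cone MK]) simp
  moreover have "?M \<in> carrier_mat ?N ?N" using car by simp
  moreover have "(\<Sum>h\<in>?W. \<Sum>h'\<in>?W. ?M $$ (\<iota> (g, h), \<iota> (g', h'))) = 1" if "g \<in> ?V" "g' \<in> ?V" for g g'
    using sG[OF that] that by (simp only: ent sum_distrib_left[symmetric] cong: sum.cong)
  moreover have "(\<Sum>g\<in>?V. \<Sum>g'\<in>?V. ?M $$ (\<iota> (g, h), \<iota> (g', h'))) = 1" if "h \<in> ?W" "h' \<in> ?W" for h h'
    using sH[OF that] that by (simp only: ent sum_distrib_left[symmetric] cong: sum.cong)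
  moreover have "?M $$ (\<iota> (g, h), \<iota> (g', h')) = 0"
    if "g \<in> ?V" "g' \<in> ?V" "h \<in> ?W" "h' \<in> ?W" "rel G g g' \<noteq> rel H h h'" for g g' h h'
    using that ent[of g h g' h'] z[OF that] by simp
  ultimately show ?thesis unfolding iso_cone_def by blast
qed

theorem mainTheorem4:
  fixes G :: "'a pair_pre_digraph" and H :: "'b pair_pre_digraph"
    and K :: "complex mat set" and \<iota> :: "'a \<times> 'b \<Rightarrow> nat"
  assumes "pair_graph G" and "pverts G \<noteq> {}"
    and "pair_graph H" and "pverts H \<noteq> {}"
    and "matrix_cone K" and "K \<subseteq> psd_mats"
    and "bij_betw \<iota> (pverts G \<times> pverts H) {..<card (pverts G \<times> pverts H)}"
  shows "iso_cone K \<iota> G H \<longleftrightarrow>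
    theta K \<iota> (G \<diamond> H) = ereal (real (card (pverts G))) \<and>
    card (pverts G) = card (pverts H) \<and>
    theta_attained K \<iota> (G \<diamond> H)"
proof -
  have fin: "finite (pverts G)" "finite (pverts H)"
    using assms(1,3)
    by (auto simp: pair_graph_def pair_digraph_def intro: pair_fin_digraph.pair_finite_verts)
  note le = theta_iso_product_le[OF fin assms(6,7)]
  show ?thesis
  proof
    assume iso: "iso_cone K \<iota> G H"
    note * = iso_cone_imp_feasible[OF fin assms(2,5,7) iso]
    from *(2) obtain M where M: "M \<in> theta_feasible K \<iota> (G \<diamond> H)"
      "theta_objective M = ereal (real (card (pverts G)))" by blast
    \<comment> \<open>The rescaled matrix reaches the upper bound \<open>le\<close>, which gives
      both the value of the supremum and its attainment.\<close>
    have "theta_objective M \<le> theta K \<iota> (G \<diamond> H)"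
      unfolding theta_def using M(1) by (rule SUP_upper)
    then have "theta K \<iota> (G \<diamond> H) = ereal (real (card (pverts G)))"
      using le M(2) by (intro antisym) auto
    then show "theta K \<iota> (G \<diamond> H) = ereal (real (card (pverts G))) \<and>
        card (pverts G) = card (pverts H) \<and> theta_attained K \<iota> (G \<diamond> H)"
      using *(1) M unfolding theta_attained_def by auto
  next
    assume "theta K \<iota> (G \<diamond> H) = ereal (real (card (pverts G))) \<and>
        card (pverts G) = card (pverts H) \<and> theta_attained K \<iota> (G \<diamond> H)"
    then show "iso_cone K \<iota> G H"
      using feasible_imp_iso_cone[OF fin assms(2,5,6,7)] unfolding theta_attained_def by auto
  qed
qed

end
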